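(* Fix $\epsilon>0$. There exist constants $c=c(\epsilon)>0$, $c'=c'(\epsilon)>0$, $c''=c''(\epsilon)>0$ and, for each $n$, a coupling of two sequences $U=(U_1,\dots,U_n)$ and $V=(V_1,\dots,V_n)$, each of which is i.i.d. $\mathrm{Unif}([0,1])$, such that for all $n$ sufficiently large the following events all occur simultaneously with probability at least $1-\epsilon$: 1. For all graphons $w$ and all sequences $u^{(2)}=\{u^{(2)}_{i,j}\}_{i,j=1}^n$, $$G(w;V,u^{(2)})=G\left(\tilde w_{c/\sqrt n};U,u^{(2)}\right).$$ 2. There is a single permutation $\sigma\in S_n$ such that $$U_{\sigma(1)}<U_{\sigma(2)}<\dots<U_{\sigma(n)}\quad\text{and}\quad V_{\sigma(1)}<V_{\sigma(2)}<\dots<V_{\sigma(n)}.$$ 3. $$\left|\left\{1\le i\le n:\ |U_i-V_i|\ge\frac{c'}{\sqrt n}\right\}\right|\ge c''n.$$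
   Context: A graphon is a symmetric measurable function $w:[0,1]^2\to[0,1]$. For a graphon $w$ and sequences $u^{(1)}=\{u^{(1)}_j\}_{j=1}^n$ and $u^{(2)}=\{u^{(2)}_{i,j}\}_{i,j=1}^n$ in $[0,1]$, $G(w;u^{(1)},u^{(2)})$ denotes the graph on $\{1,\dots,n\}$ in which $i<j$ are adjacent iff $u^{(2)}_{i,j}<w(u^{(1)}_i,u^{(1)}_j)$. For $\delta\in[0,1)$, $\tilde w_\delta(x,y)=w(x^{1-\delta},y^{1-\delta})$. *)

theory Defs
  imports "HOL-Probability.Probability" "HOL-Combinatorics.Permutations"
begin

text \<open>
  Only the values of a graphon on the unit square matter, so it is a total function on the reals
  that is constrained on \<open>[0,1]\<^sup>2\<close> only. ``Measurable'' means Lebesgue measurable.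
\<close>

definition graphon :: "(real \<Rightarrow> real \<Rightarrow> real) \<Rightarrow> bool" where
  "graphon w \<longleftrightarrow>
     (\<forall>x\<in>{0..1}. \<forall>y\<in>{0..1}. w x y \<in> {0..1} \<and> w x y = w y x) \<and>
     (\<lambda>(x, y). w x y) \<in> borel_measurable (lebesgue_on ({0..1} \<times> {0..1}))"

text \<open>A simple graph is the pair of its vertex set and its set of two-element edges.\<close>

definition sampled_graph ::
  "nat \<Rightarrow> (real \<Rightarrow> real \<Rightarrow> real) \<Rightarrow> (nat \<Rightarrow> real) \<Rightarrow> (nat \<Rightarrow> nat \<Rightarrow> real) \<Rightarrow> nat set \<times> nat set set" where
  "sampled_graph n w u1 u2 =
     ({1..n}, {{i, j} | i j. 1 \<le> i \<and> i < j \<and> j \<le> n \<and> u2 i j < w (u1 i) (u1 j)})"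

text \<open>
  Meant for \<open>0 \<le> \<delta> < 1\<close>; there \<open>0 powr (1 - \<delta>) = 0\<close> agrees with the usual power.
\<close>

definition power_rescale :: "real \<Rightarrow> (real \<Rightarrow> real \<Rightarrow> real) \<Rightarrow> real \<Rightarrow> real \<Rightarrow> real" where
  "power_rescale \<delta> w x y = w (x powr (1 - \<delta>)) (y powr (1 - \<delta>))"

text \<open>
  The uniform distribution with the unit interval itself, not the whole real line, as its space:
  every sample then lies in \<open>[0,1]\<close>, where graphons are constrained.
\<close>

definition unif01 :: "real measure" where
  "unif01 = restrict_space lborel {0..1}"

lemma space_unif01: "space unif01 = {0..1}"
  by (simp add: unif01_def space_restrict_space)

lemma prob_space_unif01: "prob_space unif01"
  by (rule prob_spaceI)
    (simp add: unif01_def space_restrict_space emeasure_restrict_space)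

lemma distr_unif01: "distr unif01 borel (\<lambda>x. x) = uniform_measure lborel {0..1}"
proof (rule measure_eqI)
  have meas: "(\<lambda>x. x) \<in> measurable unif01 borel"
    unfolding unif01_def by (intro measurable_restrict_space1) simp
  fix A assume "A \<in> sets (distr unif01 borel (\<lambda>x. x))"
  then have A: "A \<in> sets borel" by simp
  have "emeasure (distr unif01 borel (\<lambda>x. x)) A = emeasure unif01 (A \<inter> {0..1})"
    using A meas by (simp add: emeasure_distr space_unif01)
  also have "\<dots> = emeasure lborel ({0..1} \<inter> A)"
    using A by (simp add: unif01_def emeasure_restrict_space Int_commute)
  also have "\<dots> = emeasure (uniform_measure lborel {0..1}) A"
    using A by (simp add: divide_ennreal_def)
  finally show "emeasure (distr unif01 borel (\<lambda>x. x)) A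
      = emeasure (uniform_measure lborel {0..1}) A" .
qed simp

text \<open>The law of \<open>n\<close> i.i.d. uniform variables, indexed by \<open>1, \<dots>, n\<close>.\<close>

definition iid_unif01 :: "nat \<Rightarrow> (nat \<Rightarrow> real) measure" where
  "iid_unif01 n = (\<Pi>\<^sub>M i\<in>{1..n}. unif01)"

text \<open>A coupling is given by the joint law of the two coupled random elements.\<close>

definition coupling :: "'a measure \<Rightarrow> 'b measure \<Rightarrow> ('a \<times> 'b) measure \<Rightarrow> bool" where
  "coupling \<mu> \<nu> M \<longleftrightarrow>
     prob_space M \<and> sets M = sets (\<mu> \<Otimes>\<^sub>M \<nu>) \<and> distr M \<mu> fst = \<mu> \<and> distr M \<nu> snd = \<nu>"

end

(*
  Put V' = U powr (1 - c / sqrt n) coordinatewise. The graphs then agree identically, the common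
  order is kept, and a coordinate with a <= U_i <= 1 - a moves by at least a^2 c / sqrt n; by
  Markov's inequality half of the coordinates are of this kind. V' is not uniform, but its law has
  the product density g(v) = prod_i b v_i^(b-1) with b = 1 / (1 - c / sqrt n), and
  E g^2 = (b^2 / (2b - 1))^n = (1 + O(c^2 / n))^n. So the total variation distance of V' from
  the uniform law is small with c, uniformly in n, and V' can be replaced by a uniform V which
  equals V' with probability close to 1.
*)

theory Submission
  imports Defs
begin

text \<open>The shift \<open>c / sqrt n\<close> is dictated by the second moment. The density
  \<open>g\<close> has mean 1, so the linear term cancels and a shift \<open>d\<close> costs each
  coordinate only a factor of size 1 + O(d^2). The factors multiply over n coordinates, and
  \<open>n * d^2 = c^2\<close> stays bounded. The total variation distance itself does not factorize
  over coordinates, which is why it is controlled through the second moment.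

  Passing from V' to a uniform V must leave U untouched, because all three events compare U with V.
  So V' is kept with a probability that depends only on its density there, and is otherwise redrawn.
  The events then have to be checked only at pairs (U, V').

  The first event quantifies over all graphons and all arrays, so its measurability is not evident.
  Indicators of single unordered pairs of points are graphons, and testing with them turns the event
  into finitely many equations between coordinates. Ties among the U_i would defeat the second
  event, but they form a null set.\<close>

section \<open>The uniform distribution\<close>

lemma sets_unif01I: "A \<in> sets borel \<Longrightarrow> A \<subseteq> {0..1} \<Longrightarrow> A \<in> sets unif01"
  by (simp add: unif01_def sets_restrict_space_iff)

lemma measurable_unif01_borel [measurable]: "(\<lambda>x. x) \<in> unif01 \<rightarrow>\<^sub>M borel"
  unfolding unif01_def by (intro measurable_restrict_space1) simp

lemma measurable_unif01I:
  assumes "f \<in> borel_measurable M" "\<And>x. x \<in> space M \<Longrightarrow> f x \<in> {0..1}"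
  shows "f \<in> M \<rightarrow>\<^sub>M unif01"
  unfolding unif01_def using assms by (intro measurable_restrict_space2) auto

lemma borel_measurable_unif01 [measurable (raw)]:
  "f \<in> M \<rightarrow>\<^sub>M unif01 \<Longrightarrow> f \<in> borel_measurable M"
  using measurable_compose[OF _ measurable_unif01_borel] by blast

lemma emeasure_unif01_interval:
  assumes "0 \<le> a" "a \<le> b" "b \<le> 1"
  shows "emeasure unif01 {a..b} = ennreal (b - a)"
    and "emeasure unif01 {a<..b} = ennreal (b - a)"
proof -
  have "{a..b} \<subseteq> {0..1}" "{a<..b} \<subseteq> {0..1}"
    using assms by auto
  then show "emeasure unif01 {a..b} = ennreal (b - a)"
    and "emeasure unif01 {a<..b} = ennreal (b - a)"
    using assms by (auto simp: unif01_def emeasure_restrict_space)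
qed

section \<open>Coupling with the image under a map\<close>

text \<open>The integral of the deficit \<open>max 0 (1 - g x)\<close> is the total variation
  distance between the law of \<open>T\<close> and \<open>\<mu>\<close>. The second component of the
  coupling differs from \<open>T u\<close> only after a rejection, whose probability is exactly this
  distance. Hence any event can be checked on the graph of \<open>T\<close> at this price.\<close>

lemma coupling_along_map:
  fixes g :: "'a \<Rightarrow> real"
  assumes "prob_space \<mu>"
    and T [measurable]: "T \<in> \<mu> \<rightarrow>\<^sub>M \<mu>"
    and g [measurable]: "g \<in> borel_measurable \<mu>"
    and g_nonneg: "\<And>x. 0 \<le> g x"
    and law: "distr \<mu> \<mu> T = density \<mu> (\<lambda>x. ennreal (g x))"
  obtains M where "coupling \<mu> \<mu> M"
    and "\<And>A. A \<in> sets (\<mu> \<Otimes>\<^sub>M \<mu>) \<Longrightarrow>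
      measure M A \<ge> measure \<mu> {u \<in> space \<mu>. (u, T u) \<in> A} - (\<integral>x. max 0 (1 - g x) \<partial>\<mu>)"
proof -
  interpret \<mu>: prob_space \<mu> by fact
  interpret unif: prob_space unif01 by (rule prob_space_unif01)
  \<comment> \<open>Keep \<open>T u\<close> with probability \<open>\<alpha> (T u)\<close>, which cuts its density \<open>g\<close> down to \<open>min 1 g\<close>; with the
    remaining probability \<open>d\<close> draw from \<open>\<rho>\<close>, whose density is the normalized deficit \<open>1 - min 1 g\<close>.\<close>
  define d where "d = (\<integral>x. max 0 (1 - g x) \<partial>\<mu>)"
  define \<alpha> where "\<alpha> x = (if g x \<le> 1 then 1 else 1 / g x)" for x
  define \<rho> where "\<rho> = (if d = 0 then \<mu> else density \<mu> (\<lambda>x. ennreal (max 0 (1 - g x) / d)))"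
  have [measurable]: "\<alpha> \<in> borel_measurable \<mu>" unfolding \<alpha>_def by measurable
  have \<alpha>01: "0 \<le> \<alpha> x" "\<alpha> x \<le> 1" for x using g_nonneg[of x] by (auto simp: \<alpha>_def)
  have \<alpha>g: "g x * \<alpha> x = min 1 (g x)" "g x * (1 - \<alpha> x) = max 0 (g x - 1)" for x
    by (auto simp: \<alpha>_def algebra_simps)
  have d_nonneg: "0 \<le> d" by (simp add: d_def)
  have nn_d: "(\<integral>\<^sup>+x. ennreal (max 0 (1 - g x)) \<partial>\<mu>) = ennreal d"
    unfolding d_def
    by (intro nn_integral_eq_integral \<mu>.integrable_const_bound[where B = 1])
       (use g_nonneg in auto)
  have nn_g: "(\<integral>\<^sup>+x. ennreal (g x) \<partial>\<mu>) = 1"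
  proof -
    have "emeasure (distr \<mu> \<mu> T) (space \<mu>) = 1"
      using prob_space.emeasure_space_1[OF \<mu>.prob_space_distr[OF T]] by simp
    then show ?thesis unfolding law
      by (simp add: emeasure_density cong: nn_integral_cong)
  qed
  \<comment> \<open>Since \<open>g\<close> has mean 1, the mass above 1 equals the mass missing
    below 1, so the rejection probability is \<open>d\<close>. Adding 1 to both sides avoids
    subtraction in \<open>ennreal\<close>.\<close>
  have excess: "(\<integral>\<^sup>+x. ennreal (max 0 (g x - 1)) \<partial>\<mu>) = ennreal d"
  proof -
    have "(\<integral>\<^sup>+x. ennreal (max 0 (g x - 1)) \<partial>\<mu>) + 1
        = (\<integral>\<^sup>+x. ennreal (max 0 (g x - 1)) + 1 \<partial>\<mu>)"
      by (simp add: nn_integral_add \<mu>.emeasure_space_1)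
    also have "\<dots> = (\<integral>\<^sup>+x. ennreal (max 0 (1 - g x)) + ennreal (g x) \<partial>\<mu>)"
      by (intro nn_integral_cong) (use g_nonneg in \<open>auto simp: max_def simp flip: ennreal_plus ennreal_1\<close>)
    also have "\<dots> = ennreal d + 1"
      by (simp add: nn_integral_add nn_d[simplified] nn_g)
    finally show ?thesis by simp
  qed
  have \<rho>_sets [measurable_cong, simp]: "sets \<rho> = sets \<mu>" by (simp add: \<rho>_def)
  \<comment> \<open>Multiplying by \<open>d\<close> makes the identity uniform in both cases: for
    \<open>d = 0\<close> the deficit vanishes almost everywhere, and the default
    \<open>\<rho> = \<mu>\<close> has no influence.\<close>
  have \<rho>_d: "emeasure \<rho> A * ennreal d = (\<integral>\<^sup>+x. ennreal (max 0 (1 - g x)) * indicator A x \<partial>\<mu>)"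
    if [measurable]: "A \<in> sets \<mu>" for A
  proof (cases "d = 0")
    case True
    then have "AE x in \<mu>. ennreal (max 0 (1 - g x)) = 0"
      using nn_d nn_integral_0_iff_AE[of "\<lambda>x. ennreal (max 0 (1 - g x))" \<mu>] by simp
    then have "(\<integral>\<^sup>+x. ennreal (max 0 (1 - g x)) * indicator A x \<partial>\<mu>) = (\<integral>\<^sup>+x. 0 \<partial>\<mu>)"
      by (intro nn_integral_cong_AE) auto
    then show ?thesis using True by simp
  next
    case False
    then have "emeasure \<rho> A * ennreal d
        = (\<integral>\<^sup>+x. ennreal (max 0 (1 - g x) / d) * indicator A x * ennreal d \<partial>\<mu>)"
      by (simp add: \<rho>_def emeasure_density nn_integral_multc)
    also have "\<dots> = (\<integral>\<^sup>+x. ennreal (max 0 (1 - g x)) * indicator A x \<partial>\<mu>)"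
      using False d_nonneg
      by (intro nn_integral_cong) (auto simp: indicator_def simp flip: ennreal_mult')
    finally show ?thesis .
  qed
  interpret \<rho>: prob_space \<rho>
  proof (cases "d = 0")
    case True then show "prob_space \<rho>" using \<open>prob_space \<mu>\<close> by (simp add: \<rho>_def)
  next
    case False
    have "emeasure \<rho> (space \<mu>) * ennreal d = ennreal d"
      using \<rho>_d[of "space \<mu>"] nn_d by (simp cong: nn_integral_cong)
    then have "emeasure \<rho> (space \<mu>) = 1"
      using False d_nonneg
      by (metis ennreal_eq_0_iff ennreal_neq_top mult.left_neutral mult_divide_eq_ennreal order_antisym_conv)
    then show "prob_space \<rho>" by (intro prob_spaceI) (simp add: \<rho>_def split: if_splits)
  qed
  have \<rho>_space [simp]: "space \<rho> = space \<mu>" by (simp add: \<rho>_def)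
  define S where "S = unif01 \<Otimes>\<^sub>M \<rho>"
  interpret ur: pair_prob_space unif01 \<rho> ..
  interpret S: prob_space S unfolding S_def by (rule ur.prob_space_axioms)
  interpret \<Omega>: pair_prob_space \<mu> S ..
  define V where "V = (\<lambda>(u, s, r). if s \<le> \<alpha> (T u) then T u else r)"
  have V [measurable]: "V \<in> \<mu> \<Otimes>\<^sub>M S \<rightarrow>\<^sub>M \<mu>"
    unfolding V_def S_def by measurable
  have V_law: "distr (\<mu> \<Otimes>\<^sub>M S) \<mu> V = \<mu>"
  proof (rule measure_eqI)
    fix A assume "A \<in> sets (distr (\<mu> \<Otimes>\<^sub>M S) \<mu> V)"
    then have A [measurable]: "A \<in> sets \<mu>" by simp
    have inner: "(\<integral>\<^sup>+p. indicator A (V (u, p)) \<partial>S)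
        = ennreal (\<alpha> (T u)) * indicator A (T u) + ennreal (1 - \<alpha> (T u)) * emeasure \<rho> A"
      if u [measurable]: "u \<in> space \<mu>" for u
    proof -
      let ?a = "\<alpha> (T u)"
      have "(\<integral>\<^sup>+p. indicator A (V (u, p)) \<partial>S)
          = (\<integral>\<^sup>+s. \<integral>\<^sup>+r. indicator A (V (u, s, r)) \<partial>\<rho> \<partial>unif01)"
        using u unfolding S_def
        by (subst \<rho>.nn_integral_fst[symmetric]) (auto simp: S_def[symmetric])
      also have "\<dots> = (\<integral>\<^sup>+s. indicator A (T u) * indicator {0..?a} s
          + emeasure \<rho> A * indicator {?a<..1} s \<partial>unif01)"
      proof (rule nn_integral_cong)
        fix s assume "s \<in> space unif01"
        then show "(\<integral>\<^sup>+r. indicator A (V (u, s, r)) \<partial>\<rho>)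
            = indicator A (T u) * indicator {0..?a} s + emeasure \<rho> A * indicator {?a<..1} s"
          using \<rho>.emeasure_space_1 by (cases "s \<le> ?a") (simp_all add: V_def space_unif01)
      qed
      also have "\<dots> = indicator A (T u) * emeasure unif01 {0..?a}
          + emeasure \<rho> A * emeasure unif01 {?a<..1}"
      proof -
        have [measurable]: "{0..?a} \<in> sets unif01" "{?a<..1} \<in> sets unif01"
          using \<alpha>01[of "T u"] by (auto intro!: sets_unif01I)
        show ?thesis by (subst nn_integral_add) (simp_all add: nn_integral_cmult_indicator)
      qed
      finally show ?thesis
        using \<alpha>01[of "T u"] by (simp add: emeasure_unif01_interval mult.commute)
    qed
    have "emeasure (distr (\<mu> \<Otimes>\<^sub>M S) \<mu> V) A
        = (\<integral>\<^sup>+p. indicator A (V p) \<partial>(\<mu> \<Otimes>\<^sub>M S))"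
      using nn_integral_distr[OF V, of "indicator A"] by simp
    also have "\<dots> = (\<integral>\<^sup>+u. \<integral>\<^sup>+p. indicator A (V (u, p)) \<partial>S \<partial>\<mu>)"
      by (subst S.nn_integral_fst[symmetric]) auto
    also have "\<dots> = (\<integral>\<^sup>+u. ennreal (\<alpha> (T u)) * indicator A (T u)
        + ennreal (1 - \<alpha> (T u)) * emeasure \<rho> A \<partial>\<mu>)"
      by (intro nn_integral_cong) (simp add: inner)
    also have "\<dots> = (\<integral>\<^sup>+x. ennreal (\<alpha> x) * indicator A x
        + ennreal (1 - \<alpha> x) * emeasure \<rho> A \<partial>distr \<mu> \<mu> T)"
      by (subst nn_integral_distr) auto
    \<comment> \<open>Weighting by \<open>g\<close> turns \<open>\<alpha>\<close> into
      \<open>min 1 g\<close> and \<open>1 - \<alpha>\<close> into the excess. The excess has total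
      mass \<open>d\<close>, and redistributing it by \<open>\<rho>\<close> refills exactly the
      deficit.\<close>
    also have "\<dots> = (\<integral>\<^sup>+x. ennreal (min 1 (g x)) * indicator A x
        + ennreal (max 0 (g x - 1)) * emeasure \<rho> A \<partial>\<mu>)"
      unfolding law using g_nonneg \<alpha>01
      by (subst nn_integral_density)
         (auto intro!: nn_integral_cong simp: distrib_left simp flip: \<alpha>g mult.assoc ennreal_mult)
    also have "\<dots> = (\<integral>\<^sup>+x. ennreal (min 1 (g x)) * indicator A x \<partial>\<mu>)
        + emeasure \<rho> A * ennreal d"
      by (simp add: nn_integral_add nn_integral_multc excess[simplified]
          mult.commute[of "ennreal d"])
    also have "\<dots> = (\<integral>\<^sup>+x. ennreal (min 1 (g x)) * indicator A x
        + ennreal (max 0 (1 - g x)) * indicator A x \<partial>\<mu>)"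
      by (simp add: nn_integral_add \<rho>_d)
    also have "\<dots> = (\<integral>\<^sup>+x. indicator A x \<partial>\<mu>)"
      by (intro nn_integral_cong)
         (use g_nonneg in \<open>auto simp: indicator_def max_def simp flip: ennreal_plus\<close>)
    finally show "emeasure (distr (\<mu> \<Otimes>\<^sub>M S) \<mu> V) A = emeasure \<mu> A" by simp
  qed simp
  define M where "M = distr (\<mu> \<Otimes>\<^sub>M S) (\<mu> \<Otimes>\<^sub>M \<mu>) (\<lambda>p. (fst p, V p))"
  have "coupling \<mu> \<mu> M"
    unfolding coupling_def
  proof (intro conjI)
    show "prob_space M" unfolding M_def by (intro \<Omega>.prob_space_distr) simp
    show "sets M = sets (\<mu> \<Otimes>\<^sub>M \<mu>)" by (simp add: M_def)
    have "distr (\<mu> \<Otimes>\<^sub>M S) \<mu> fst = \<mu>"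
      by (rule S.distr_pair_fst)
    then show "distr M \<mu> fst = \<mu>" by (simp add: M_def distr_distr comp_def)
    show "distr M \<mu> snd = \<mu>" using V_law by (simp add: M_def distr_distr comp_def)
  qed
  moreover have "measure M A \<ge> measure \<mu> {u \<in> space \<mu>. (u, T u) \<in> A} - d"
    if A [measurable]: "A \<in> sets (\<mu> \<Otimes>\<^sub>M \<mu>)" for A
  proof -
    define B where "B = {u \<in> space \<mu>. (u, T u) \<in> A}"
    \<comment> \<open>\<open>R\<close> is the rejection event. Outside it the pair is
      \<open>(u, T u)\<close>, so \<open>u \<in> B\<close> ensures \<open>A\<close> there.\<close>
    define R where "R = {p \<in> space (\<mu> \<Otimes>\<^sub>M S). \<alpha> (T (fst p)) < fst (snd p)}"
    have [measurable]: "B \<in> sets \<mu>" unfolding B_def by measurable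
    have R [measurable]: "R \<in> sets (\<mu> \<Otimes>\<^sub>M S)" unfolding R_def S_def by measurable
    have "emeasure (\<mu> \<Otimes>\<^sub>M S) R = (\<integral>\<^sup>+u. emeasure S (Pair u -` R) \<partial>\<mu>)"
      by (rule S.emeasure_pair_measure_alt) fact
    also have "\<dots> = (\<integral>\<^sup>+u. ennreal (1 - \<alpha> (T u)) \<partial>\<mu>)"
    proof (rule nn_integral_cong)
      fix u assume "u \<in> space \<mu>"
      then have "Pair u -` R = {\<alpha> (T u)<..1} \<times> space \<mu>"
        using \<alpha>01[of "T u"]
        by (auto simp: R_def S_def space_pair_measure space_unif01)
      then show "emeasure S (Pair u -` R) = ennreal (1 - \<alpha> (T u))"
        using \<alpha>01[of "T u"] \<rho>.emeasure_space_1 unfolding S_def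
        by (simp add: \<rho>.emeasure_pair_measure_Times emeasure_unif01_interval
            sets_unif01I subset_iff)
    qed
    also have "\<dots> = (\<integral>\<^sup>+x. ennreal (1 - \<alpha> x) \<partial>distr \<mu> \<mu> T)"
      by (subst nn_integral_distr) auto
    also have "\<dots> = (\<integral>\<^sup>+x. ennreal (max 0 (g x - 1)) \<partial>\<mu>)"
      unfolding law using g_nonneg \<alpha>01
      by (subst nn_integral_density)
         (auto intro!: nn_integral_cong simp flip: \<alpha>g ennreal_mult)
    finally have R_d: "measure (\<mu> \<Otimes>\<^sub>M S) R = d"
      using d_nonneg by (simp add: excess[simplified] measure_def)
    have B: "measure (\<mu> \<Otimes>\<^sub>M S) (B \<times> space S) = measure \<mu> B"
      by (simp add: measure_def S.emeasure_pair_measure_Times S.emeasure_space_1)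
    have "B \<times> space S \<subseteq> ((\<lambda>p. (fst p, V p)) -` A \<inter> space (\<mu> \<Otimes>\<^sub>M S)) \<union> R"
      by (auto simp: B_def R_def V_def space_pair_measure)
    then have "measure (\<mu> \<Otimes>\<^sub>M S) (B \<times> space S)
        \<le> measure (\<mu> \<Otimes>\<^sub>M S) (((\<lambda>p. (fst p, V p)) -` A \<inter> space (\<mu> \<Otimes>\<^sub>M S)) \<union> R)"
      by (intro \<Omega>.finite_measure_mono) auto
    also have "\<dots> \<le> measure (\<mu> \<Otimes>\<^sub>M S) ((\<lambda>p. (fst p, V p)) -` A \<inter> space (\<mu> \<Otimes>\<^sub>M S))
        + measure (\<mu> \<Otimes>\<^sub>M S) R"
      by (intro measure_Un_le) auto
    also have "measure (\<mu> \<Otimes>\<^sub>M S) ((\<lambda>p. (fst p, V p)) -` A \<inter> space (\<mu> \<Otimes>\<^sub>M S)) = measure M A"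
      unfolding M_def by (subst measure_distr) auto
    finally show ?thesis using B R_d by (simp add: B_def)
  qed
  ultimately show thesis using that unfolding d_def by blast
qed

section \<open>The law of powers of uniform variables\<close>

text \<open>The substitution rule asks for a two-sided derivative on all of [0,1], including the
  endpoint 0. There the difference quotient is \<open>(h powr b) / h\<close>; as
  \<open>h powr b\<close> equals \<open>\<bar>h\<bar> powr b\<close> for negative \<open>h\<close>
  too, its modulus is \<open>\<bar>h\<bar> powr (b - 1)\<close>, which tends to 0 because
  \<open>1 < b\<close>.\<close>

lemma has_real_derivative_powr_nonneg:
  fixes b x :: real
  assumes "1 < b" "0 \<le> x"
  shows "((\<lambda>x. x powr b) has_real_derivative b * x powr (b - 1)) (at x)"
proof (cases "x = 0")
  case False
  then show ?thesis using assms by (auto intro!: derivative_eq_intros)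
next
  case True
  have "((\<lambda>h::real. (h powr b) / h) \<longlongrightarrow> 0) (at 0)"
  proof (rule tendsto_rabs_zero_cancel, rule Lim_transform_eventually)
    have "((\<lambda>h::real. \<bar>h\<bar> powr (b - 1)) \<longlongrightarrow> \<bar>0\<bar> powr (b - 1)) (at 0)"
      by (intro tendsto_powr' tendsto_intros) (use assms in auto)
    then show "((\<lambda>h::real. \<bar>h\<bar> powr (b - 1)) \<longlongrightarrow> 0) (at 0)" by simp
    show "\<forall>\<^sub>F h in at 0. \<bar>h\<bar> powr (b - 1) = \<bar>(h powr b) / h\<bar>"
    proof -
      have "\<bar>h\<bar> powr (b - 1) = \<bar>(h powr b) / h\<bar>" if "h \<noteq> 0" for h :: real
      proof -
        have "h powr b = \<bar>h\<bar> powr b"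
          by (cases "0 < h") (simp_all add: powr_def ln_minus)
        then show ?thesis using that by (simp add: powr_diff)
      qed
      then show ?thesis by (simp add: eventually_at_filter)
    qed
  qed
  then show ?thesis using True assms by (simp add: DERIV_def)
qed

lemma distr_unif01_powr:
  fixes d :: real
  assumes d: "0 < d" "d < 1"
  defines "b \<equiv> 1 / (1 - d)"
  shows "distr unif01 unif01 (\<lambda>x. x powr (1 - d))
    = density unif01 (\<lambda>x. ennreal (b * x powr (b - 1)))" (is "?L = ?R")
proof (rule measure_eqI)
  have b: "1 < b" using d by (simp add: b_def)
  have inv: "(x powr b) powr (1 - d) = x" if "0 \<le> x" for x
    using d that by (simp add: powr_powr b_def)
  have [measurable]: "(\<lambda>x. x powr (1 - d)) \<in> unif01 \<rightarrow>\<^sub>M unif01"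
    using d by (intro measurable_unif01I) (auto simp: space_unif01 powr_le1)
  fix A assume "A \<in> sets ?L"
  then have A: "A \<in> sets unif01" by simp
  then have [measurable]: "A \<in> sets borel"
    by (auto simp: unif01_def sets_restrict_space_iff)
  have "emeasure ?L A = (\<integral>\<^sup>+x. indicator A (x powr (1 - d)) \<partial>unif01)"
    using A nn_integral_distr[of "\<lambda>x. x powr (1 - d)" unif01 unif01 "indicator A"] by simp
  \<comment> \<open>The unit interval is written as the range between the images of its endpoints
    under the inverse map \<open>x powr b\<close>, the shape that the substitution rule
    expects.\<close>
  also have "\<dots> = (\<integral>\<^sup>+x. ennreal (indicator A (x powr (1 - d)) * indicator {0 powr b..1 powr b} x) \<partial>lborel)"
    unfolding unif01_def
    by (subst nn_integral_restrict_space) (auto intro!: nn_integral_cong simp: indicator_def)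
  also have "\<dots> = (\<integral>\<^sup>+x. ennreal (indicator A ((x powr b) powr (1 - d)) * (b * x powr (b - 1)) * indicator {0..1} x) \<partial>lborel)"
  proof (rule nn_integral_substitution)
    show "continuous_on {0..1} (\<lambda>x. b * x powr (b - 1))"
      using b by (intro continuous_intros continuous_on_powr') auto
  qed (use b in \<open>auto simp: set_borel_measurable_def intro!: has_real_derivative_powr_nonneg\<close>)
  also have "\<dots> = (\<integral>\<^sup>+x. ennreal (b * x powr (b - 1)) * indicator A x \<partial>unif01)"
    unfolding unif01_def
    by (subst nn_integral_restrict_space)
       (use b in \<open>auto intro!: nn_integral_cong simp: indicator_def inv\<close>)
  also have "\<dots> = emeasure ?R A"
    using A by (subst emeasure_density) auto
  finally show "emeasure ?L A = emeasure ?R A" .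
qed simp

lemma unif01_integral_powr:
  fixes p :: real
  assumes "0 \<le> p"
  shows "integrable unif01 (\<lambda>x. x powr p)" "(\<integral>x. x powr p \<partial>unif01) = 1 / (p + 1)"
proof -
  have "((\<lambda>x. x powr p) has_integral 1 / (p + 1)) {0..1}"
    using has_integral_powr_from_0[of p 1] assms by simp
  then have "((\<lambda>x. indicator {0..1} x * x powr p) has_integral 1 / (p + 1)) UNIV"
    by (subst (asm) has_integral_restrict_UNIV[symmetric])
       (auto elim!: has_integral_eq[rotated] simp: indicator_def)
  then have "(\<integral>\<^sup>+x. ennreal (indicator {0..1} x * x powr p) \<partial>lborel) = ennreal (1 / (p + 1))"
    by (intro nn_integral_has_integral_lborel) auto
  then have nn: "(\<integral>\<^sup>+x. ennreal (x powr p) \<partial>unif01) = ennreal (1 / (p + 1))"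
    unfolding unif01_def
    by (subst nn_integral_restrict_space) (simp_all add: ennreal_mult ennreal_indicator mult.commute)
  have "has_bochner_integral unif01 (\<lambda>x. x powr p) (1 / (p + 1))"
    by (intro has_bochner_integral_nn_integral nn) (use assms in auto)
  then show "integrable unif01 (\<lambda>x. x powr p)" "(\<integral>x. x powr p \<partial>unif01) = 1 / (p + 1)"
    by (auto simp: has_bochner_integral_iff)
qed

text \<open>A finite product measure is determined by its values on boxes, and over a box the
  integral of the product density factorizes.\<close>

lemma density_PiM:
  assumes "finite I" "\<And>i. i \<in> I \<Longrightarrow> prob_space (M i)"
    and f [measurable]: "\<And>i. i \<in> I \<Longrightarrow> f i \<in> borel_measurable (M i)"
    and "\<And>i. i \<in> I \<Longrightarrow> prob_space (density (M i) (f i))"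
  shows "PiM I (\<lambda>i. density (M i) (f i)) = density (PiM I M) (\<lambda>x. \<Prod>i\<in>I. f i (x i))"
proof -
  \<comment> \<open>The product locale wants a sigma-finite factor at every index, while the
    assumptions speak only of \<open>I\<close>. A point mass fills in the other indices without
    changing the product over \<open>I\<close>.\<close>
  define N where "N i = (if i \<in> I then M i else return (count_space UNIV) undefined)" for i
  define D where "D i = (if i \<in> I then density (M i) (f i) else return (count_space UNIV) undefined)" for i
  have pN: "prob_space (N i)" and pD: "prob_space (D i)" for i
    using assms by (auto simp: N_def D_def intro!: prob_space_return)
  interpret N: product_sigma_finite N
    by (simp add: product_sigma_finite_def pN prob_space_imp_sigma_finite)
  interpret D: product_sigma_finite D
    by (simp add: product_sigma_finite_def pD prob_space_imp_sigma_finite)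
  have f' [measurable]: "f i \<in> borel_measurable (N i)" if "i \<in> I" for i
    using f that by (simp add: N_def)
  have "density (PiM I N) (\<lambda>x. \<Prod>i\<in>I. f i (x i)) = PiM I D"
  proof (rule D.PiM_eqI)
    show "sets (density (PiM I N) (\<lambda>x. \<Prod>i\<in>I. f i (x i))) = sets (PiM I D)"
      by (auto simp: N_def D_def intro!: sets_PiM_cong)
    fix A assume "\<And>i. i \<in> I \<Longrightarrow> A i \<in> sets (D i)"
    then have A [measurable]: "\<And>i. i \<in> I \<Longrightarrow> A i \<in> sets (N i)" by (simp add: N_def D_def)
    have "emeasure (density (PiM I N) (\<lambda>x. \<Prod>i\<in>I. f i (x i))) (Pi\<^sub>E I A)
        = (\<integral>\<^sup>+x. (\<Prod>i\<in>I. f i (x i)) * indicator (Pi\<^sub>E I A) x \<partial>PiM I N)"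
      using \<open>finite I\<close> by (intro emeasure_density) (auto intro!: sets_PiM_I_finite A)
    also have "\<dots> = (\<integral>\<^sup>+x. (\<Prod>i\<in>I. f i (x i) * indicator (A i) (x i)) \<partial>PiM I N)"
    proof (rule nn_integral_cong)
      fix x assume "x \<in> space (PiM I N)"
      \<comment> \<open>Membership in \<open>Pi\<^sub>E I A\<close> includes extensionality, which
        every point of the product space has. A point outside the box therefore violates some
        \<open>A i\<close>, and the product of indicators vanishes.\<close>
      then have ext: "x \<in> extensional I" by (simp add: space_PiM PiE_iff)
      have "indicator (Pi\<^sub>E I A) x = (\<Prod>i\<in>I. indicator (A i) (x i) :: ennreal)"
      proof (cases "x \<in> Pi\<^sub>E I A")
        case True
        then show ?thesis by (simp add: PiE_iff)
      next
        case False
        then obtain i where "i \<in> I" "x i \<notin> A i" using ext by (auto simp: PiE_iff)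
        then show ?thesis
          using False \<open>finite I\<close> by (subst prod_zero) (auto intro!: bexI[of _ i])
      qed
      then show "(\<Prod>i\<in>I. f i (x i)) * indicator (Pi\<^sub>E I A) x
          = (\<Prod>i\<in>I. f i (x i) * indicator (A i) (x i))"
        by (simp add: prod.distrib)
    qed
    also have "\<dots> = (\<Prod>i\<in>I. \<integral>\<^sup>+y. f i y * indicator (A i) y \<partial>N i)"
      using \<open>finite I\<close> by (intro N.product_nn_integral_prod) auto
    also have "\<dots> = (\<Prod>i\<in>I. emeasure (D i) (A i))"
      using A by (intro prod.cong) (auto simp: D_def N_def emeasure_density)
    finally show "emeasure (density (PiM I N) (\<lambda>x. \<Prod>i\<in>I. f i (x i))) (Pi\<^sub>E I A)
        = (\<Prod>i\<in>I. emeasure (D i) (A i))" .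
  qed fact
  moreover have "PiM I N = PiM I M" "PiM I D = PiM I (\<lambda>i. density (M i) (f i))"
    by (auto simp: N_def D_def intro!: PiM_cong)
  ultimately show ?thesis by simp
qed

section \<open>Second moment and total variation for n independent coordinates\<close>

lemma prob_space_iid_unif01: "prob_space (iid_unif01 n)"
  unfolding iid_unif01_def by (intro prob_space_PiM prob_space_unif01)

text \<open>Completing the square gives \<open>1 - y \<le> t + (1 - y)^2 / (4 * t)\<close>, and the
  mean of \<open>(1 - g)^2\<close> is the second moment minus 1. The free parameter \<open>t\<close>
  takes the place of the square root in the Cauchy-Schwarz inequality.\<close>

lemma (in prob_space) deficit_le_second_moment:
  fixes g :: "'a \<Rightarrow> real"
  assumes int: "integrable M g" "integrable M (\<lambda>x. (g x)\<^sup>2)"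
    and mean: "(\<integral>x. g x \<partial>M) = 1" and "0 < t"
  shows "(\<integral>x. max 0 (1 - g x) \<partial>M) \<le> t + ((\<integral>x. (g x)\<^sup>2 \<partial>M) - 1) / (4 * t)"
proof -
  have "max 0 (1 - y) \<le> t + (1 - 2 * y + y\<^sup>2) / (4 * t)" for y :: real
  proof -
    have "t + (1 - 2 * y + y\<^sup>2) / (4 * t) - (1 - y) = (2 * t - (1 - y))\<^sup>2 / (4 * t)"
      using \<open>0 < t\<close> by (simp add: field_simps power2_eq_square)
    also have "\<dots> \<ge> 0" using \<open>0 < t\<close> by simp
    finally have "1 - y \<le> t + (1 - 2 * y + y\<^sup>2) / (4 * t)" by simp
    moreover have "1 - 2 * y + y\<^sup>2 = (1 - y)\<^sup>2" by (simp add: power2_eq_square algebra_simps)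
    ultimately show ?thesis using \<open>0 < t\<close> by simp
  qed
  then have "(\<integral>x. max 0 (1 - g x) \<partial>M) \<le> (\<integral>x. t + (1 - 2 * g x + (g x)\<^sup>2) / (4 * t) \<partial>M)"
    using int by (intro integral_mono) auto
  also have "\<dots> = t + (1 - 2 * 1 + (\<integral>x. (g x)\<^sup>2 \<partial>M)) / (4 * t)"
    using int by (simp add: mean prob_space)
  finally show ?thesis by simp
qed

text \<open>The loss is the deficit bound for the product density, whose second moment is the n-th
  power of that of one coordinate. The assumption on \<open>n * d^2\<close> keeps the exponent
  \<open>4 * n * d^2\<close> in the range where exp has a linear bound.\<close>

lemma iid_unif01_coupling_along_powr:
  fixes d t :: real
  assumes d: "0 < d" "d \<le> 1 / 2" and nd: "4 * real n * d\<^sup>2 \<le> 1" and t: "0 < t"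
  obtains M where "coupling (iid_unif01 n) (iid_unif01 n) M"
    and "\<And>A. A \<in> sets (iid_unif01 n \<Otimes>\<^sub>M iid_unif01 n) \<Longrightarrow>
      measure M A \<ge> measure (iid_unif01 n)
        {u \<in> space (iid_unif01 n). (u, \<lambda>i\<in>{1..n}. u i powr (1 - d)) \<in> A}
        - (t + 2 * real n * d\<^sup>2 / t)"
proof -
  define b where "b = 1 / (1 - d)"
  have b: "1 < b" "b - 1 \<le> 2 * d"
    using d by (auto simp: b_def field_simps power2_eq_square)
  let ?\<mu> = "iid_unif01 n" and ?I = "{1..n}"
  let ?f = "\<lambda>x. b * x powr (b - 1)"
  let ?T = "compose ?I (\<lambda>x. x powr (1 - d))"
  let ?g = "\<lambda>u. \<Prod>i\<in>?I. ?f (u i)"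
  interpret \<mu>: prob_space ?\<mu> by (rule prob_space_iid_unif01)
  interpret unif: prob_space unif01 by (rule prob_space_unif01)
  interpret PP: product_sigma_finite "\<lambda>i :: nat. unif01" ..
  have T1 [measurable]: "(\<lambda>x. x powr (1 - d)) \<in> unif01 \<rightarrow>\<^sub>M unif01"
    using d by (intro measurable_unif01I) (auto simp: space_unif01 powr_le1)
  have T: "?T \<in> ?\<mu> \<rightarrow>\<^sub>M ?\<mu>" unfolding iid_unif01_def compose_def by measurable
  have g: "?g \<in> borel_measurable ?\<mu>" unfolding iid_unif01_def by measurable
  have f_int: "integrable unif01 ?f" "(\<integral>x. ?f x \<partial>unif01) = 1"
    using b unif01_integral_powr[of "b - 1"] by auto
  have f_sq: "(?f x)\<^sup>2 = b\<^sup>2 * x powr (2 * b - 2)" for x :: real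
    by (simp add: power_mult_distrib powr_add[symmetric] power2_eq_square)
  have f_int2: "integrable unif01 (\<lambda>x. (?f x)\<^sup>2)" "(\<integral>x. (?f x)\<^sup>2 \<partial>unif01) = b\<^sup>2 / (2 * b - 1)"
    using b unif01_integral_powr[of "2 * b - 2"] by (auto simp: f_sq)
  have density: "prob_space (density unif01 (\<lambda>x. ennreal (?f x)))"
    using distr_unif01_powr[of d] d unif.prob_space_distr[OF T1] by (simp add: b_def)
  have "distr ?\<mu> ?\<mu> ?T = PiM ?I (\<lambda>i. distr unif01 unif01 (\<lambda>x. x powr (1 - d)))"
    unfolding iid_unif01_def
    by (intro distr_PiM_finite_prob_space') (auto intro: prob_space_unif01)
  also have "\<dots> = PiM ?I (\<lambda>i. density unif01 (\<lambda>x. ennreal (?f x)))"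
    using d by (simp add: distr_unif01_powr b_def)
  also have "\<dots> = density ?\<mu> (\<lambda>u. \<Prod>i\<in>?I. ennreal (?f (u i)))"
    unfolding iid_unif01_def
    by (intro density_PiM density) (auto intro: prob_space_unif01)
  also have "\<dots> = density ?\<mu> (\<lambda>u. ennreal (?g u))"
    using b by (simp add: prod_ennreal)
  finally have law: "distr ?\<mu> ?\<mu> ?T = density ?\<mu> (\<lambda>u. ennreal (?g u))" .
  have g_int: "integrable ?\<mu> ?g" "(\<integral>u. ?g u \<partial>?\<mu>) = 1"
    unfolding iid_unif01_def
    by (intro PP.product_integrable_prod finite_atLeastAtMost f_int(1))
       (simp only: PP.product_integral_prod[OF finite_atLeastAtMost f_int(1)] f_int(2) prod.neutral_const)
  have g_sq: "(?g u)\<^sup>2 = (\<Prod>i\<in>?I. (?f (u i))\<^sup>2)" for u :: "nat \<Rightarrow> real"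
    by (simp only: prod_power_distrib)
  have g_int2: "integrable ?\<mu> (\<lambda>u. (?g u)\<^sup>2)" "(\<integral>u. (?g u)\<^sup>2 \<partial>?\<mu>) = (b\<^sup>2 / (2 * b - 1)) ^ n"
    unfolding iid_unif01_def g_sq
    by (intro PP.product_integrable_prod finite_atLeastAtMost f_int2(1))
       (simp add: PP.product_integral_prod[OF finite_atLeastAtMost f_int2(1)] f_int2(2)
         del: power_mult_distrib)
  \<comment> \<open>For one coordinate the excess over 1 is \<open>(b - 1)^2 / (2 * b - 1)\<close>,
    at most \<open>(2 * d)^2\<close>. With x = \<open>4 * n * d^2\<close>, the n factors together
    are at most exp x, and exp x \<le> 1 + x + x^2 \<le> 1 + 2 x on [0,1] yields the constant
    8.\<close>
  have second_moment: "(b\<^sup>2 / (2 * b - 1)) ^ n \<le> 1 + 8 * real n * d\<^sup>2"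
  proof -
    have "b\<^sup>2 / (2 * b - 1) \<le> 1 + (b - 1)\<^sup>2"
    proof -
      have "b\<^sup>2 / (2 * b - 1) = 1 + (b - 1)\<^sup>2 / (2 * b - 1)"
        using b by (simp add: field_simps power2_eq_square)
      also have "\<dots> \<le> 1 + (b - 1)\<^sup>2 / 1"
        using b by (intro add_left_mono divide_left_mono) auto
      finally show ?thesis by simp
    qed
    also have "\<dots> \<le> 1 + (2 * d)\<^sup>2"
      using b by (intro add_left_mono power_mono) auto
    also have "\<dots> \<le> exp ((2 * d)\<^sup>2)" by (rule exp_ge_add_one_self)
    finally have "(b\<^sup>2 / (2 * b - 1)) ^ n \<le> exp ((2 * d)\<^sup>2) ^ n"
      using b by (intro power_mono) auto
    also have "\<dots> = exp (4 * real n * d\<^sup>2)"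
      by (simp add: exp_of_nat_mult[symmetric] power_mult_distrib mult_ac)
    also have "\<dots> \<le> 1 + 4 * real n * d\<^sup>2 + (4 * real n * d\<^sup>2)\<^sup>2"
      using nd by (intro exp_bound) auto
    also have "(4 * real n * d\<^sup>2)\<^sup>2 \<le> (4 * real n * d\<^sup>2) ^ 1"
      using nd by (intro power_decreasing) auto
    finally show ?thesis by simp
  qed
  have deficit: "(\<integral>u. max 0 (1 - ?g u) \<partial>?\<mu>) \<le> t + 2 * real n * d\<^sup>2 / t"
  proof -
    have "(\<integral>u. max 0 (1 - ?g u) \<partial>?\<mu>) \<le> t + ((b\<^sup>2 / (2 * b - 1)) ^ n - 1) / (4 * t)"
      using \<mu>.deficit_le_second_moment[OF g_int(1) g_int2(1) g_int(2) t] by (simp only: g_int2(2))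
    also have "\<dots> \<le> t + (8 * real n * d\<^sup>2) / (4 * t)"
      using t second_moment by (intro add_left_mono divide_right_mono) auto
    finally show ?thesis by simp
  qed
  obtain M where M: "coupling ?\<mu> ?\<mu> M"
    "\<And>A. A \<in> sets (?\<mu> \<Otimes>\<^sub>M ?\<mu>) \<Longrightarrow>
      measure M A \<ge> measure ?\<mu> {u \<in> space ?\<mu>. (u, ?T u) \<in> A} - (\<integral>u. max 0 (1 - ?g u) \<partial>?\<mu>)"
    by (rule coupling_along_map[OF \<mu>.prob_space_axioms T g _ law]) (use b in \<open>auto intro!: prod_nonneg\<close>)
  show thesis
  proof (rule that[OF M(1)])
    fix A assume "A \<in> sets (?\<mu> \<Otimes>\<^sub>M ?\<mu>)"
    from M(2)[OF this] deficit
    show "measure M A \<ge> measure ?\<mu> {u \<in> space ?\<mu>. (u, \<lambda>i\<in>?I. u i powr (1 - d)) \<in> A}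
        - (t + 2 * real n * d\<^sup>2 / t)"
      by (simp add: compose_def)
  qed
qed

section \<open>The events and their measurability\<close>

lemma measurable_iid_unif01_component:
  "i \<in> {1..n} \<Longrightarrow> (\<lambda>u. u i) \<in> iid_unif01 n \<rightarrow>\<^sub>M unif01"
  unfolding iid_unif01_def by (rule measurable_component_singleton)

lemma space_iid_unif01D: "u \<in> space (iid_unif01 n) \<Longrightarrow> i \<in> {1..n} \<Longrightarrow> u i \<in> {0..1}"
  unfolding space_unif01[symmetric] by (rule measurable_space[OF measurable_iid_unif01_component])

text \<open>This replaces a quantifier over uncountably many graphons and arrays by a finite
  condition, from which measurability can be read off. The swapped alternative is unavoidable: a
  symmetric function cannot tell a pair from its reversal.\<close>

lemma power_rescale_graphs_agree_iff:
  assumes d: "d < 1"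
    and U: "\<And>i. i \<in> {1..n} \<Longrightarrow> U i \<in> {0..1}" and V: "\<And>i. i \<in> {1..n} \<Longrightarrow> V i \<in> {0..1}"
  shows "(\<forall>w u2. graphon w \<longrightarrow> (\<forall>i\<in>{1..n}. \<forall>j\<in>{1..n}. u2 i j \<in> {0..1}) \<longrightarrow>
            sampled_graph n w V u2 = sampled_graph n (power_rescale d w) U u2)
    \<longleftrightarrow> (\<forall>i\<in>{1..n}. \<forall>j\<in>{1..n}. i < j \<longrightarrow>
            V i = U i powr (1 - d) \<and> V j = U j powr (1 - d) \<or>
            V i = U j powr (1 - d) \<and> V j = U i powr (1 - d))"
    (is "?agree \<longleftrightarrow> (\<forall>i\<in>?I. \<forall>j\<in>?I. i < j \<longrightarrow> ?same i j)")
proof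
  have W: "U i powr (1 - d) \<in> {0..1}" if "i \<in> {1..n}" for i
    using U[OF that] d by (auto intro: powr_le1)
  show "\<forall>i\<in>?I. \<forall>j\<in>?I. i < j \<longrightarrow> ?same i j" if agree: ?agree
  proof (intro ballI impI)
    fix i j assume ij: "i \<in> ?I" "j \<in> ?I" "i < j"
    \<comment> \<open>The indicator of the unordered pair \<open>{V i, V j}\<close> is a graphon that separates it from any other.\<close>
    define D where "D = {(V i, V j), (V j, V i)}"
    define w :: "real \<Rightarrow> real \<Rightarrow> real" where "w x y = indicator D (x, y)" for x y
    have "D \<in> sets borel" unfolding D_def by (intro borel_closed finite_imp_closed) simp
    then have "D \<in> sets lebesgue" by (intro sets_completionI_sets) simp
    then have "(indicator D :: real \<times> real \<Rightarrow> real) \<in> borel_measurable (lebesgue_on ({0..1} \<times> {0..1}))"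
      by (intro measurable_restrict_space1 borel_measurable_indicator)
    moreover have "(\<lambda>(x, y). w x y) = indicator D"
      by (simp add: fun_eq_iff w_def)
    moreover have "w x y \<in> {0..1}" "w x y = w y x" for x y
      by (auto simp: w_def D_def indicator_def)
    ultimately have "graphon w" unfolding graphon_def by metis
    \<comment> \<open>With the constant array 1/2, an edge records exactly whether the 0-1 valued
      \<open>w\<close> takes the value 1.\<close>
    then have "snd (sampled_graph n w V (\<lambda>_ _. 1 / 2))
        = snd (sampled_graph n (power_rescale d w) U (\<lambda>_ _. 1 / 2))"
      using agree by simp
    moreover have "{i, j} \<in> snd (sampled_graph n w V (\<lambda>_ _. 1 / 2))"
      unfolding sampled_graph_def snd_conv
      by (rule CollectI, rule exI[of _ i], rule exI[of _ j]) (use ij in \<open>simp add: w_def D_def\<close>)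
    ultimately have "{i, j} \<in> snd (sampled_graph n (power_rescale d w) U (\<lambda>_ _. 1 / 2))"
      by simp
    then have "1 / 2 < power_rescale d w (U i) (U j)"
      using ij by (auto simp: sampled_graph_def doubleton_eq_iff)
    then have "(U i powr (1 - d), U j powr (1 - d)) \<in> D"
      unfolding power_rescale_def w_def by (rule contrapos_pp) simp
    then show "?same i j" unfolding D_def by fastforce
  qed
  show ?agree if same: "\<forall>i\<in>?I. \<forall>j\<in>?I. i < j \<longrightarrow> ?same i j"
  proof (intro allI impI)
    fix w u2 assume w: "graphon w"
    have "w (V i) (V j) = power_rescale d w (U i) (U j)" if "1 \<le> i" "i < j" "j \<le> n" for i j
    proof -
      have ij: "i \<in> ?I" "j \<in> ?I" using that by auto
      then have "?same i j" using same that by blast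
      moreover have "w (U j powr (1 - d)) (U i powr (1 - d)) = w (U i powr (1 - d)) (U j powr (1 - d))"
        using w W[OF ij(1)] W[OF ij(2)] unfolding graphon_def by blast
      ultimately show ?thesis unfolding power_rescale_def by metis
    qed
    then show "sampled_graph n w V u2 = sampled_graph n (power_rescale d w) U u2"
      unfolding sampled_graph_def by (auto 4 4)
  qed
qed

lemma ex_permutation_strict_mono:
  fixes u :: "nat \<Rightarrow> 'a :: linorder"
  assumes inj: "inj_on u {1..n}"
  shows "\<exists>\<sigma>. \<sigma> permutes {1..n} \<and> strict_mono_on {1..n} (\<lambda>i. u (\<sigma> i))"
proof -
  define xs where "xs = sorted_list_of_set (u ` {1..n})"
  have xs: "set xs = u ` {1..n}" "length xs = n" "sorted_wrt (<) xs"
    using inj by (auto simp: xs_def card_image)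
  \<comment> \<open>Lists are indexed from 0 and vertices from 1, hence \<open>i - 1\<close>.
    Outside \<open>{1..n}\<close> the identity is forced by \<open>permutes\<close>.\<close>
  define \<sigma> where "\<sigma> i = (if i \<in> {1..n} then inv_into {1..n} u (xs ! (i - 1)) else i)" for i
  have nth: "xs ! (i - 1) \<in> u ` {1..n}" if "i \<in> {1..n}" for i
  proof -
    have "i - 1 < length xs" using that xs(2) by auto
    from nth_mem[OF this] show ?thesis by (simp only: xs(1))
  qed
  have u\<sigma>: "u (\<sigma> i) = xs ! (i - 1)" and \<sigma>: "\<sigma> i \<in> {1..n}" if "i \<in> {1..n}" for i
    using that f_inv_into_f[OF nth[OF that]] inv_into_into[OF nth[OF that]]
    unfolding \<sigma>_def by (simp_all del: atLeastAtMost_iff)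
  have mono: "strict_mono_on {1..n} (\<lambda>i. u (\<sigma> i))"
  proof (rule strict_mono_onI)
    fix i j :: nat assume ij: "i \<in> {1..n}" "j \<in> {1..n}" "i < j"
    then have "i - 1 < j - 1" "j - 1 < n" by auto
    then have "i - 1 < j - 1" "j - 1 < length xs" unfolding xs(2) .
    then have "xs ! (i - 1) < xs ! (j - 1)" by (rule sorted_wrt_nth_less[OF xs(3)])
    then show "u (\<sigma> i) < u (\<sigma> j)" by (simp only: u\<sigma>[OF ij(1)] u\<sigma>[OF ij(2)])
  qed
  have "inj_on \<sigma> {1..n}"
  proof (rule inj_onI)
    fix i j assume "i \<in> {1..n}" "j \<in> {1..n}" "\<sigma> i = \<sigma> j"
    then show "i = j"
      using strict_mono_onD[OF mono, of i j] strict_mono_onD[OF mono, of j i]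
      by (cases i j rule: linorder_cases) auto
  qed
  then have "bij_betw \<sigma> {1..n} {1..n}"
    using endo_inj_surj[of "{1..n}" \<sigma>] \<sigma> unfolding bij_betw_def by blast
  then have "\<sigma> permutes {1..n}"
    by (rule bij_imp_permutes) (auto simp: \<sigma>_def)
  with mono show ?thesis by blast
qed

text \<open>The difference is u (exp (- d ln u) - 1) \<ge> d u (- ln u) \<ge> d u (1 - u), and both
  \<open>u\<close> and \<open>1 - u\<close> are at least \<open>a\<close>.\<close>

lemma powr_gap:
  fixes a d u :: real
  assumes "0 < a" "a \<le> u" "u \<le> 1 - a" "0 < d"
  shows "a\<^sup>2 * d \<le> u powr (1 - d) - u"
proof -
  have "a * a \<le> u * (1 - u)" using assms by (intro mult_mono) auto
  then have "a\<^sup>2 * d \<le> u * (d * (1 - u))"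
    using \<open>0 < d\<close> by (simp add: power2_eq_square mult_ac)
  also have "\<dots> \<le> u * (d * (- ln u))"
    using assms ln_le_minus_one[of u] by (intro mult_left_mono) auto
  also have "\<dots> \<le> u * (exp (- d * ln u) - 1)"
    using assms exp_ge_add_one_self[of "- d * ln u"] by (intro mult_left_mono) auto
  also have "\<dots> = u powr (1 - d) - u"
  proof -
    have "u powr (1 - d) = u powr 1 * u powr (- d)"
      using powr_add[of u 1 "- d"] assms by simp
    then show ?thesis using assms by (simp add: powr_def algebra_simps)
  qed
  finally show ?thesis .
qed

text \<open>A tie would leave no strictly increasing arrangement. For fixed values of the other
  coordinates, \<open>u i = u j\<close> confines \<open>u i\<close> to a single point, which has
  measure 0; Fubini and a finite intersection do the rest.\<close>

lemma AE_iid_unif01_inj: "AE u in iid_unif01 n. inj_on u {1..n}"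
proof -
  interpret PP: product_sigma_finite "\<lambda>i :: nat. unif01"
    by (simp add: product_sigma_finite_def prob_space_unif01 prob_space_imp_sigma_finite)
  have [measurable]: "(\<lambda>u. u i) \<in> borel_measurable (PiM {1..n} (\<lambda>i. unif01))" if "i \<in> {1..n}" for i
    using that by measurable
  have "AE u in PiM {1..n} (\<lambda>i. unif01). u i \<noteq> u j" if ij: "i \<in> {1..n}" "j \<in> {1..n}" "i \<noteq> j" for i j
  proof -
    let ?f = "\<lambda>u. indicator {0} (u i - u j) :: ennreal"
    have f: "?f \<in> borel_measurable (PiM {1..n} (\<lambda>i. unif01))"
      using ij by measurable
    have I: "{1..n} = insert i ({1..n} - {i})" using ij by auto
    have "integral\<^sup>N (PiM {1..n} (\<lambda>i. unif01)) ?f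
        = (\<integral>\<^sup>+x. \<integral>\<^sup>+y. ?f (x(i := y)) \<partial>unif01 \<partial>PiM ({1..n} - {i}) (\<lambda>i. unif01))"
      using PP.product_nn_integral_insert[of "{1..n} - {i}" i ?f] f I by simp
    also have "\<dots> = (\<integral>\<^sup>+x. 0 \<partial>PiM ({1..n} - {i}) (\<lambda>i. unif01))"
    proof (rule nn_integral_cong)
      fix x assume "x \<in> space (PiM ({1..n} - {i}) (\<lambda>i. unif01))"
      then have x: "0 \<le> x j" "x j \<le> 1" using ij by (auto simp: space_PiM space_unif01 PiE_iff)
      have "(\<integral>\<^sup>+y. ?f (x(i := y)) \<partial>unif01) = (\<integral>\<^sup>+y. indicator {x j} y \<partial>unif01)"
        using ij by (intro nn_integral_cong) (auto simp: indicator_def)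
      also have "\<dots> = emeasure unif01 {x j}"
        using x by (intro nn_integral_indicator sets_unif01I) auto
      finally show "(\<integral>\<^sup>+y. ?f (x(i := y)) \<partial>unif01) = 0"
        using emeasure_unif01_interval(1)[of "x j" "x j"] x by simp
    qed
    also have "\<dots> = 0" by simp
    finally have "AE u in PiM {1..n} (\<lambda>i. unif01). ?f u = 0"
      by (rule iffD1[OF nn_integral_0_iff_AE[OF f]])
    then show ?thesis by eventually_elim (auto simp: indicator_def split: if_splits)
  qed
  then have "AE u in PiM {1..n} (\<lambda>i. unif01). \<forall>i\<in>{1..n}. \<forall>j\<in>{1..n}. i \<noteq> j \<longrightarrow> u i \<noteq> u j"
    by (intro AE_finite_allI finite_atLeastAtMost AE_impI) blast
  then show ?thesis unfolding iid_unif01_def by eventually_elim (auto simp: inj_on_def)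
qed

text \<open>The number \<open>Y\<close> of coordinates outside \<open>[a, 1 - a]\<close> has mean
  \<open>2 * a * n\<close>, so by Markov's inequality it reaches \<open>n / 2\<close> with
  probability at most \<open>4 * a\<close>.\<close>

lemma iid_unif01_many_central:
  assumes a: "0 < a" "a \<le> 1 / 2" and n: "0 < n"
  shows "measure (iid_unif01 n)
      {u \<in> space (iid_unif01 n). real n / 2 \<le> card {i \<in> {1..n}. u i \<in> {a..1 - a}}} \<ge> 1 - 4 * a"
proof -
  let ?\<mu> = "iid_unif01 n" and ?J = "{a..1 - a}"
  interpret \<mu>: prob_space ?\<mu> by (rule prob_space_iid_unif01)
  interpret unif: prob_space unif01 by (rule prob_space_unif01)
  have comp [measurable]: "(\<lambda>u. u i) \<in> ?\<mu> \<rightarrow>\<^sub>M unif01" if "i \<in> {1..n}" for i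
    using that unfolding iid_unif01_def by measurable
  have J: "?J \<in> sets unif01" using a by (intro sets_unif01I) auto
  define Y where "Y u = (\<Sum>i\<in>{1..n}. indicator (- ?J) (u i) :: real)" for u
  have [measurable]: "Y \<in> borel_measurable ?\<mu>" unfolding Y_def by measurable
  have int: "integrable ?\<mu> (\<lambda>u. indicator (- ?J) (u i) :: real)" if "i \<in> {1..n}" for i
    using that by (intro \<mu>.integrable_const_bound[where B = 1]) (auto simp: indicator_def)
  have mean: "(\<integral>u. indicator (- ?J) (u i) \<partial>?\<mu>) = 2 * a" if i: "i \<in> {1..n}" for i
  proof -
    have "distr ?\<mu> unif01 (\<lambda>u. u i) = unif01"
      unfolding iid_unif01_def using i by (intro distr_PiM_component prob_space_unif01)
    then have "(\<integral>u. indicator (- ?J) (u i) \<partial>?\<mu>) = (\<integral>x. indicator (- ?J) x \<partial>unif01 :: real)"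
      using integral_distr[OF comp[OF i], of "indicator (- ?J) :: real \<Rightarrow> real"] by simp
    also have "\<dots> = (\<integral>x. indicator (space unif01 - ?J) x \<partial>unif01)"
      by (intro Bochner_Integration.integral_cong) (auto simp: indicator_def)
    also have "\<dots> = measure unif01 (space unif01 - ?J)" using J by simp
    also have "\<dots> = 1 - measure unif01 ?J" by (rule unif.prob_compl[OF J])
    also have "measure unif01 ?J = 1 - 2 * a"
      using a by (simp add: measure_def emeasure_unif01_interval)
    finally show ?thesis by simp
  qed
  have "measure ?\<mu> {u \<in> space ?\<mu>. real n / 2 \<le> Y u} \<le> (\<integral>u. Y u \<partial>?\<mu>) / (real n / 2)"
    using n int by (intro integral_Markov_inequality_measure[where A = "{}"])
      (auto simp: Y_def intro!: sum_nonneg)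
  also have "\<dots> = 4 * a"
    using n int mean by (simp add: Y_def)
  finally have "measure ?\<mu> {u \<in> space ?\<mu>. \<not> real n / 2 \<le> Y u} \<ge> 1 - 4 * a"
    by (subst \<mu>.prob_neg) auto
  also have "measure ?\<mu> {u \<in> space ?\<mu>. \<not> real n / 2 \<le> Y u}
      \<le> measure ?\<mu> {u \<in> space ?\<mu>. real n / 2 \<le> card {i \<in> {1..n}. u i \<in> ?J}}"
  proof (intro \<mu>.finite_measure_mono subsetI)
    have eq: "real (card {i \<in> {1..n}. u i \<in> ?J}) = real n - Y u" for u
    proof -
      have "real n - Y u = (\<Sum>i\<in>{1..n}. 1 - indicator (- ?J) (u i))"
        by (simp add: Y_def sum_subtractf)
      also have "\<dots> = (\<Sum>i\<in>{1..n}. if u i \<in> ?J then 1 else 0)"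
        by (intro sum.cong) auto
      also have "\<dots> = real (card {i \<in> {1..n}. u i \<in> ?J})"
        by (simp add: sum.If_cases Int_def)
      finally show ?thesis by simp
    qed
    show "u \<in> {u \<in> space ?\<mu>. real n / 2 \<le> card {i \<in> {1..n}. u i \<in> ?J}}"
      if "u \<in> {u \<in> space ?\<mu>. \<not> real n / 2 \<le> Y u}" for u
      using that by (simp only: eq mem_Collect_eq) simp
    show "{u \<in> space ?\<mu>. real n / 2 \<le> card {i \<in> {1..n}. u i \<in> ?J}} \<in> sets ?\<mu>"
      unfolding eq by measurable
  qed
  finally show ?thesis .
qed

section \<open>Measurability of the three events for any measure on the pair space\<close>

context
  fixes n :: nat and M :: "((nat \<Rightarrow> real) \<times> (nat \<Rightarrow> real)) measure"
  assumes sets_M: "sets M = sets (iid_unif01 n \<Otimes>\<^sub>M iid_unif01 n)"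
begin

lemma space_iid_pair: "space M = space (iid_unif01 n) \<times> space (iid_unif01 n)"
  using sets_eq_imp_space_eq[OF sets_M] by (simp add: space_pair_measure)

lemma measurable_iid_pair_component:
  assumes "i \<in> {1..n}"
  shows "(\<lambda>p. fst p i) \<in> borel_measurable M" "(\<lambda>p. snd p i) \<in> borel_measurable M"
  using measurable_compose[OF measurable_fst measurable_iid_unif01_component[OF assms]]
    measurable_compose[OF measurable_snd measurable_iid_unif01_component[OF assms]]
  by (auto simp: measurable_cong_sets[OF sets_M refl] intro!: borel_measurable_unif01)

lemma graphs_agree_event_eq:
  assumes "d < 1"
  shows "{(U, V). (U, V) \<in> space M \<and>
            (\<forall>w u2. graphon w \<longrightarrow> (\<forall>i\<in>{1..n}. \<forall>j\<in>{1..n}. u2 i j \<in> {0..1}) \<longrightarrow>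
              sampled_graph n w V u2 = sampled_graph n (power_rescale d w) U u2)}
    = {(U, V). (U, V) \<in> space M \<and>
        (\<forall>i\<in>{1..n}. \<forall>j\<in>{1..n}. i < j \<longrightarrow>
            V i = U i powr (1 - d) \<and> V j = U j powr (1 - d) \<or>
            V i = U j powr (1 - d) \<and> V j = U i powr (1 - d))}" (is "?L = ?R")
proof (rule set_eqI)
  fix p :: "(nat \<Rightarrow> real) \<times> (nat \<Rightarrow> real)"
  obtain U V where p: "p = (U, V)" by (cases p)
  show "p \<in> ?L \<longleftrightarrow> p \<in> ?R"
    unfolding p mem_Collect_eq prod.case
  proof (intro conj_cong refl power_rescale_graphs_agree_iff assms)
    fix i assume "(U, V) \<in> space M" "i \<in> {1..n}"
    then show "U i \<in> {0..1}" "V i \<in> {0..1}"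
      unfolding space_iid_pair by (blast intro: space_iid_unif01D)+
  qed
qed

lemma sets_graphs_agree_event:
  assumes "d < 1"
  shows "{(U, V). (U, V) \<in> space M \<and>
            (\<forall>w u2. graphon w \<longrightarrow> (\<forall>i\<in>{1..n}. \<forall>j\<in>{1..n}. u2 i j \<in> {0..1}) \<longrightarrow>
              sampled_graph n w V u2 = sampled_graph n (power_rescale d w) U u2)} \<in> sets M"
proof -
  note [measurable] = measurable_iid_pair_component
  have "{(U, V). (U, V) \<in> space M \<and>
        (\<forall>i\<in>{1..n}. \<forall>j\<in>{1..n}. i < j \<longrightarrow>
            V i = U i powr (1 - d) \<and> V j = U j powr (1 - d) \<or>
            V i = U j powr (1 - d) \<and> V j = U i powr (1 - d))}
    = {p \<in> space M. \<forall>i\<in>{1..n}. \<forall>j\<in>{1..n}. i < j \<longrightarrow>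
        snd p i = fst p i powr (1 - d) \<and> snd p j = fst p j powr (1 - d) \<or>
        snd p i = fst p j powr (1 - d) \<and> snd p j = fst p i powr (1 - d)}"
    unfolding case_prod_beta' prod.collapse by (rule refl)
  also have "\<dots> \<in> sets M" by measurable
  finally show ?thesis unfolding graphs_agree_event_eq[OF assms] .
qed

text \<open>There are finitely many permutations, so the event is a finite union of sets given by
  finitely many strict inequalities.\<close>

lemma sets_same_order_event:
  "{(U, V). (U, V) \<in> space M \<and>
      (\<exists>\<sigma>. \<sigma> permutes {1..n} \<and> strict_mono_on {1..n} (\<lambda>i. U (\<sigma> i)) \<and>
        strict_mono_on {1..n} (\<lambda>i. V (\<sigma> i)))} \<in> sets M"
proof -
  have iff: "strict_mono_on I f \<and> strict_mono_on I g \<longleftrightarrow>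
      (\<forall>i\<in>I. \<forall>j\<in>I. i < j \<longrightarrow> f i < f j \<and> g i < g j)" for I :: "nat set" and f g :: "nat \<Rightarrow> real"
    unfolding strict_mono_on_def by blast
  have "{(U, V). (U, V) \<in> space M \<and>
      (\<exists>\<sigma>. \<sigma> permutes {1..n} \<and> strict_mono_on {1..n} (\<lambda>i. U (\<sigma> i)) \<and>
        strict_mono_on {1..n} (\<lambda>i. V (\<sigma> i)))}
    = (\<Union>\<sigma>\<in>{\<sigma>. \<sigma> permutes {1..n}}. {p \<in> space M. \<forall>i\<in>{1..n}. \<forall>j\<in>{1..n}. i < j \<longrightarrow>
          fst p (\<sigma> i) < fst p (\<sigma> j) \<and> snd p (\<sigma> i) < snd p (\<sigma> j)})"
    unfolding iff case_prod_beta' prod.collapse by blast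
  also have "\<dots> \<in> sets M"
  proof (intro sets.finite_UN finite_permutations finite_atLeastAtMost)
    fix \<sigma> assume "\<sigma> \<in> {\<sigma>. \<sigma> permutes {1..n}}"
    then have "\<sigma> i \<in> {1..n}" if "i \<in> {1..n}" for i
      using that permutes_in_image[of \<sigma> "{1..n}" i] by blast
    note [measurable] = measurable_iid_pair_component[OF this]
    show "{p \<in> space M. \<forall>i\<in>{1..n}. \<forall>j\<in>{1..n}. i < j \<longrightarrow>
        fst p (\<sigma> i) < fst p (\<sigma> j) \<and> snd p (\<sigma> i) < snd p (\<sigma> j)} \<in> sets M"
      by measurable
  qed
  finally show ?thesis .
qed

lemma sets_many_far_event:
  fixes r s :: real
  shows "{(U, V). (U, V) \<in> space M \<and> real (card {i \<in> {1..n}. \<bar>U i - V i\<bar> \<ge> r}) \<ge> s} \<in> sets M"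
proof -
  note [measurable] = measurable_iid_pair_component
  have "{(U, V). (U, V) \<in> space M \<and> real (card {i \<in> {1..n}. \<bar>U i - V i\<bar> \<ge> r}) \<ge> s}
    = {p \<in> space M. s \<le> (\<Sum>i\<in>{1..n}. if r \<le> \<bar>fst p i - snd p i\<bar> then 1 else 0)}"
    unfolding case_prod_beta' prod.collapse by (simp add: sum.If_cases Int_def)
  also have "\<dots> \<in> sets M" by measurable
  finally show ?thesis .
qed

end

theorem theorem4:
  fixes \<epsilon> :: real
  assumes "\<epsilon> > 0"
  shows "\<exists>c > 0. \<exists>c' > 0. \<exists>c'' > 0. \<exists>M :: nat \<Rightarrow> ((nat \<Rightarrow> real) \<times> (nat \<Rightarrow> real)) measure.
    (\<forall>n. coupling (iid_unif01 n) (iid_unif01 n) (M n)) \<and>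
    (\<forall>\<^sub>F n in sequentially.
      let E1 = {(U, V). (U, V) \<in> space (M n) \<and>
                 (\<forall>w u2. graphon w \<longrightarrow> (\<forall>i\<in>{1..n}. \<forall>j\<in>{1..n}. u2 i j \<in> {0..1}) \<longrightarrow>
                    sampled_graph n w V u2
                      = sampled_graph n (power_rescale (c / sqrt (real n)) w) U u2)};
          E2 = {(U, V). (U, V) \<in> space (M n) \<and>
                 (\<exists>\<sigma>. \<sigma> permutes {1..n} \<and> strict_mono_on {1..n} (\<lambda>i. U (\<sigma> i)) \<and>
                    strict_mono_on {1..n} (\<lambda>i. V (\<sigma> i)))};
          E3 = {(U, V). (U, V) \<in> space (M n) \<and>
                 real (card {i \<in> {1..n}. \<bar>U i - V i\<bar> \<ge> c' / sqrt (real n)}) \<ge> c'' * real n}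
      in E1 \<in> sets (M n) \<and> E2 \<in> sets (M n) \<and> E3 \<in> sets (M n) \<and>
         measure (M n) (E1 \<inter> E2 \<inter> E3) \<ge> 1 - \<epsilon>)"
proof -
  \<comment> \<open>Capping at 1 keeps the constants below in the ranges that the lemmas
    require.\<close>
  define e where "e = min \<epsilon> 1"
  have e: "0 < e" "e \<le> \<epsilon>" "e \<le> 1" using assms by (auto simp: e_def)
  \<comment> \<open>Error budget: too few central coordinates cost \<open>4 * a = e / 4\<close>. The
    coupling with \<open>t = e / 4\<close> costs \<open>t + 2 * c^2 / t\<close>, which is
    \<open>e / 4 + e / 8\<close> for \<open>c = e / 8\<close>. The total \<open>5 / 8 * e\<close> is
    below \<open>\<epsilon>\<close>.\<close>
  define a where "a = e / 16"
  define c where "c = e / 8"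
  have a: "0 < a" "a \<le> 1 / 2" and c: "0 < c" "c \<le> 1 / 8" using e by (auto simp: a_def c_def)
  define \<delta> where "\<delta> n = c / sqrt (real n)" for n
  define T where "T n u = (\<lambda>i\<in>{1..n}. u i powr (1 - \<delta> n))" for n and u :: "nat \<Rightarrow> real"
  have \<delta>: "0 < \<delta> n" "\<delta> n \<le> 1 / 8" "real n * (\<delta> n)\<^sup>2 = c\<^sup>2" if "1 \<le> n" for n
  proof -
    have "1 \<le> sqrt (real n)" using that by simp
    then have "c / sqrt (real n) \<le> c / 1" using c by (intro divide_left_mono) auto
    then show "\<delta> n \<le> 1 / 8" using c unfolding \<delta>_def by linarith
    show "0 < \<delta> n" unfolding \<delta>_def using c that by (intro divide_pos_pos) auto
    have "(sqrt (real n))\<^sup>2 = real n" by simp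
    then show "real n * (\<delta> n)\<^sup>2 = c\<^sup>2"
      unfolding \<delta>_def power_divide using that by simp
  qed
  have "\<forall>n. \<exists>M. coupling (iid_unif01 n) (iid_unif01 n) M \<and>
      (1 \<le> n \<longrightarrow> (\<forall>A. A \<in> sets (iid_unif01 n \<Otimes>\<^sub>M iid_unif01 n) \<longrightarrow>
        measure M A \<ge> measure (iid_unif01 n) {u \<in> space (iid_unif01 n). (u, T n u) \<in> A} - 3 / 8 * e))"
    (is "\<forall>n. ?P n")
  proof
    fix n
    show "?P n"
    proof (cases "1 \<le> n")
      case True
      have "c\<^sup>2 \<le> (1 / 8)\<^sup>2" using c by (intro power_mono) auto
      then have small: "4 * real n * (\<delta> n)\<^sup>2 \<le> 1"
        using \<delta>(3)[OF True] by (simp add: power2_eq_square mult.assoc)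
      have "2 * real n * (\<delta> n)\<^sup>2 = 2 * c\<^sup>2" using \<delta>(3)[OF True] by simp
      then have loss: "e / 4 + 2 * real n * (\<delta> n)\<^sup>2 / (e / 4) = 3 / 8 * e"
        using e by (simp add: c_def power2_eq_square)
      have le: "\<delta> n \<le> 1 / 2" and pos: "0 < e / 4" using \<delta>(2)[OF True] e by auto
      show ?thesis
        by (rule iid_unif01_coupling_along_powr[OF \<delta>(1)[OF True] le small pos])
           (unfold loss T_def, blast)
    next
      case False
      interpret \<mu>: prob_space "iid_unif01 n" by (rule prob_space_iid_unif01)
      \<comment> \<open>A coupling is required for every \<open>n\<close>; for \<open>n = 0\<close>
        nothing else is claimed, and the diagonal one serves.\<close>
      have "coupling (iid_unif01 n) (iid_unif01 n) (distr (iid_unif01 n) (iid_unif01 n \<Otimes>\<^sub>M iid_unif01 n) (\<lambda>u. (u, u)))"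
        by (auto simp: coupling_def distr_distr comp_def distr_id2 intro!: \<mu>.prob_space_distr)
      then show ?thesis using False by blast
    qed
  qed
  from choice[OF this] obtain M
    where M: "coupling (iid_unif01 n) (iid_unif01 n) (M n)"
    and M_ge: "1 \<le> n \<Longrightarrow> A \<in> sets (iid_unif01 n \<Otimes>\<^sub>M iid_unif01 n) \<Longrightarrow>
        measure (M n) A \<ge> measure (iid_unif01 n) {u \<in> space (iid_unif01 n). (u, T n u) \<in> A} - 3 / 8 * e"
    for n A by blast
  have events: "let E1 = {(U, V). (U, V) \<in> space (M n) \<and>
                 (\<forall>w u2. graphon w \<longrightarrow> (\<forall>i\<in>{1..n}. \<forall>j\<in>{1..n}. u2 i j \<in> {0..1}) \<longrightarrow>
                    sampled_graph n w V u2
                      = sampled_graph n (power_rescale (c / sqrt (real n)) w) U u2)};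
          E2 = {(U, V). (U, V) \<in> space (M n) \<and>
                 (\<exists>\<sigma>. \<sigma> permutes {1..n} \<and> strict_mono_on {1..n} (\<lambda>i. U (\<sigma> i)) \<and>
                    strict_mono_on {1..n} (\<lambda>i. V (\<sigma> i)))};
          E3 = {(U, V). (U, V) \<in> space (M n) \<and>
                 real (card {i \<in> {1..n}. \<bar>U i - V i\<bar> \<ge> a\<^sup>2 * c / sqrt (real n)}) \<ge> 1 / 2 * real n}
      in E1 \<in> sets (M n) \<and> E2 \<in> sets (M n) \<and> E3 \<in> sets (M n) \<and>
         measure (M n) (E1 \<inter> E2 \<inter> E3) \<ge> 1 - \<epsilon>" (is "let E1 = ?E1; E2 = ?E2; E3 = ?E3 in _")
    if n: "1 \<le> n" for n
  proof -
    let ?\<mu> = "iid_unif01 n" and ?I = "{1..n}" and ?\<delta> = "\<delta> n"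
    interpret \<mu>: prob_space ?\<mu> by (rule prob_space_iid_unif01)
    note \<delta>n = \<delta>[OF n]
    have \<delta>1: "c / sqrt (real n) < 1" using \<delta>n(2) unfolding \<delta>_def by linarith
    have sets_M: "sets (M n) = sets (?\<mu> \<Otimes>\<^sub>M ?\<mu>)"
      using M[of n] by (simp add: coupling_def)
    note E1 = sets_graphs_agree_event[OF sets_M \<delta>1]
      and E2 = sets_same_order_event[OF sets_M]
      and E3 = sets_many_far_event[OF sets_M, where r = "a\<^sup>2 * c / sqrt (real n)" and s = "1 / 2 * real n"]
    let ?C = "{u \<in> space ?\<mu>. real n / 2 \<le> card {i \<in> ?I. u i \<in> {a..1 - a}}}"
    let ?G = "{u \<in> space ?\<mu>. (u, T n u) \<in> ?E1 \<inter> ?E2 \<inter> ?E3}"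
    \<comment> \<open>On the graph of \<open>T n\<close> nothing random is left: many central
      coordinates and no ties already imply all three events.\<close>
    have good: "(u, T n u) \<in> ?E1 \<inter> ?E2 \<inter> ?E3" if u: "u \<in> ?C" and inj: "inj_on u ?I" for u
    proof -
      have u01: "0 \<le> u i" "u i \<le> 1" if "i \<in> ?I" for i using space_iid_unif01D[of u n i] u that by auto
      have Tu: "T n u i = u i powr (1 - ?\<delta>)" if "i \<in> ?I" for i using that by (simp add: T_def)
      have "T n u \<in> space ?\<mu>"
        using u01 \<delta>n by (auto simp: T_def iid_unif01_def space_PiM space_unif01 powr_le1)
      then have sp: "(u, T n u) \<in> space (M n)" using u by (simp add: space_iid_pair[OF sets_M])
      have "(u, T n u) \<in> ?E1"
        unfolding graphs_agree_event_eq[OF sets_M \<delta>1] using sp Tu by (auto simp: \<delta>_def)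
      moreover have "(u, T n u) \<in> ?E2"
      proof -
        obtain \<sigma> where \<sigma>: "\<sigma> permutes ?I" "strict_mono_on ?I (\<lambda>i. u (\<sigma> i))"
          using ex_permutation_strict_mono[OF inj] by blast
        have "strict_mono_on ?I (\<lambda>i. T n u (\<sigma> i))"
        proof (rule strict_mono_onI)
          fix i j assume ij: "i \<in> ?I" "j \<in> ?I" "i < j"
          then have "\<sigma> i \<in> ?I" "\<sigma> j \<in> ?I" using permutes_in_image[OF \<sigma>(1)] by blast+
          then show "T n u (\<sigma> i) < T n u (\<sigma> j)"
            using u01(1) strict_mono_onD[OF \<sigma>(2) ij] \<delta>n(2) Tu
            by (auto intro!: powr_less_mono2)
        qed
        with \<sigma> sp show ?thesis by blast
      qed
      moreover have "(u, T n u) \<in> ?E3"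
      proof -
        \<comment> \<open>This is where c' = \<open>a^2 * c\<close> comes from:
          \<open>powr_gap\<close> at shift \<open>c / sqrt n\<close>.\<close>
        have "\<bar>u i - T n u i\<bar> \<ge> a\<^sup>2 * c / sqrt (real n)" if "i \<in> ?I" "u i \<in> {a..1 - a}" for i
          using powr_gap[of a "u i" ?\<delta>] that a \<delta>n(1) Tu by (auto simp: \<delta>_def)
        then have "card {i \<in> ?I. u i \<in> {a..1 - a}}
            \<le> card {i \<in> ?I. \<bar>u i - T n u i\<bar> \<ge> a\<^sup>2 * c / sqrt (real n)}"
          by (intro card_mono) auto
        moreover have "real n / 2 \<le> card {i \<in> ?I. u i \<in> {a..1 - a}}" using u by blast
        ultimately show ?thesis using sp by simp
      qed
      ultimately show ?thesis by blast
    qed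
    have T_meas: "(\<lambda>u. (u, T n u)) \<in> ?\<mu> \<rightarrow>\<^sub>M ?\<mu> \<Otimes>\<^sub>M ?\<mu>"
    proof -
      have "(\<lambda>x. x powr (1 - ?\<delta>)) \<in> unif01 \<rightarrow>\<^sub>M unif01"
        using \<delta>n by (intro measurable_unif01I) (auto simp: space_unif01 powr_le1)
      then have "T n \<in> ?\<mu> \<rightarrow>\<^sub>M ?\<mu>"
        unfolding T_def iid_unif01_def
        by (intro measurable_restrict measurable_compose[OF measurable_component_singleton])
      then show ?thesis by simp
    qed
    have E: "?E1 \<inter> ?E2 \<inter> ?E3 \<in> sets (?\<mu> \<Otimes>\<^sub>M ?\<mu>)"
      using E1 E2 E3 unfolding sets_M by (intro sets.Int)
    have "1 - 4 * a \<le> measure ?\<mu> ?C"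
      using a n by (intro iid_unif01_many_central) auto
    also have "\<dots> \<le> measure ?\<mu> ?G"
    \<comment> \<open>The inclusion of \<open>?C\<close> in \<open>?G\<close> is needed only off the
      null set of ties.\<close>
    proof (rule \<mu>.finite_measure_mono_AE)
      show "AE u in ?\<mu>. u \<in> ?C \<longrightarrow> u \<in> ?G"
        using AE_iid_unif01_inj[of n]
      proof eventually_elim
        case (elim u)
        then show ?case using good[of u] by blast
      qed
      show "?G \<in> sets ?\<mu>"
        using measurable_sets[OF T_meas E] by (simp add: vimage_def Int_def conj_commute)
    qed
    finally have "1 - 4 * a \<le> measure ?\<mu> ?G" .
    then have "1 - \<epsilon> \<le> measure (M n) (?E1 \<inter> ?E2 \<inter> ?E3)"
      using M_ge[OF n E] e by (simp add: a_def)
    with E1 E2 E3 show ?thesis unfolding Let_def by (intro conjI)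
  qed
  have pos: "0 < c" "0 < a\<^sup>2 * c" "0 < (1 / 2 :: real)" using a c by simp_all
  show ?thesis
    by (rule exI[of _ c], rule conjI[OF pos(1)], rule exI[of _ "a\<^sup>2 * c"], rule conjI[OF pos(2)],
        rule exI[of _ "1 / 2"], rule conjI[OF pos(3)], rule exI[of _ M], rule conjI[OF allI[OF M]],
        rule eventually_sequentiallyI[of 1], rule events)
qed

end
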